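(* Let $1\le n<m\le N$, let $\Phi\in\mathbb R^{N\times m}$ be a basis matrix and $S\in\mathbb R^{N\times n}$ a selection matrix such that $S^\top\Phi$ has full rank $n$, and let $Z$ be a kernel matrix of $S^\top\Phi$. Let $\mathbf f:\mathbb R^N\to\mathbb R^N$ be Lipschitz continuous, let $\mathbf u(t)$ solve $\dot{\mathbf u}=\mathbf f(\mathbf u)$, $\mathbf u(0)=\mathbf u_0$, and let $\mathbf y(t)=S^\top\mathbf u(t)$. For a path $\mathbf z(t)\in\mathcal N[S^\top\Phi]$ let $$\tilde{\mathbf u}(\mathbf z(t))=\Phi(S^\top\Phi)^+\mathbf y(t)+\Phi\mathbf z(t),$$ and consider the instantaneous optimization problem $$\min_{\dot{\mathbf z}(t)}\left\|\frac{\mathrm d}{\mathrm dt}\tilde{\mathbf u}(\mathbf z(t))-\mathbf f(\tilde{\mathbf u}(\mathbf z(t)))\right\|^2,\qquad \frac{\mathrm d}{\mathrm dt}\tilde{\mathbf u}(\mathbf z(t))=\Phi(S^\top\Phi)^+\dot{\mathbf y}(t)+\Phi\dot{\mathbf z}(t),$$ where at each time $t$ the current value $\mathbf z(t)$ is given and the minimum is over $\dot{\mathbf z}(t)\in\mathcal N[S^\top\Phi]$. This problem has a unique solution, given by $\mathbf z(t)=Z\boldsymbol\xi(t)$ (so that $\dot{\mathbf z}(t)=Z\dot{\boldsymbol\xi}(t)$), where $\boldsymbol\xi(t)\in\mathbb R^{m-n}$ solves the ODE $$\dot{\boldsymbol\xi}=Z^\top\Phi^\top\mathbf f\big(\tilde{\mathbf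 u}(Z\boldsymbol\xi)\big).$$
   Context: A basis matrix $\Phi\in\mathbb R^{N\times m}$ is a real matrix with orthonormal columns, $\Phi^\top\Phi=\mathbb I_m$. A selection matrix $S\in\mathbb R^{N\times n}$ is a matrix $[\mathbf e_{i_1}|\cdots|\mathbf e_{i_n}]$ whose columns are standard basis vectors of $\mathbb R^N$ with distinct indices. $A^+$ is the Moore--Penrose pseudoinverse of $A$, $\mathcal N[A]$ is its null space, and $\|\cdot\|$ is the Euclidean norm. A kernel matrix $Z\in\mathbb R^{m\times(m-n)}$ is a matrix whose columns form an orthonormal basis of $\mathcal N[S^\top\Phi]$. Here $\tilde{\mathbf u}(Z\boldsymbol\xi)$ at time $t$ means $\Phi(S^\top\Phi)^+\mathbf y(t)+\Phi Z\boldsymbol\xi(t)$. Since the path $\mathbf z(t)$ stays in the fixed subspace $\mathcal N[S^\top\Phi]$, its derivative also lies in that subspace. *)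

theory Defs
  imports "HOL-Analysis.Analysis"
begin

definition basis_matrix :: "real^'m^'N \<Rightarrow> bool" where
  "basis_matrix \<Phi> \<longleftrightarrow> transpose \<Phi> ** \<Phi> = mat 1"

definition selection_matrix :: "real^'n^'N \<Rightarrow> bool" where
  "selection_matrix S \<longleftrightarrow> (\<exists>i :: 'n \<Rightarrow> 'N. inj i \<and> (\<forall>j. column j S = axis (i j) 1))"

definition null_space :: "real^'n^'m \<Rightarrow> (real^'n) set" where
  "null_space A = {x. A *v x = 0}"

definition kernel_matrix :: "real^'m^'n \<Rightarrow> real^'k^'m \<Rightarrow> bool" where
  "kernel_matrix A Z \<longleftrightarrow>
     (\<forall>i j. column i Z \<bullet> column j Z = (if i = j then 1 else 0)) \<and>
     span (columns Z) = null_space A"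

definition moore_penrose :: "real^'n^'m \<Rightarrow> real^'m^'n \<Rightarrow> bool" where
  "moore_penrose A X \<longleftrightarrow>
     A ** X ** A = A \<and> X ** A ** X = X \<and>
     transpose (A ** X) = A ** X \<and> transpose (X ** A) = X ** A"

definition pinv :: "real^'n^'m \<Rightarrow> real^'m^'n" where
  "pinv A = (THE X. moore_penrose A X)"

lemma normal_equations_solvable:
  fixes A :: "real^'n^'m"
  obtains X :: "real^'m^'n" where "transpose A ** A ** X = transpose A"
proof -
  have ex: "\<exists>x. transpose A *v (A *v x) = transpose A *v b" for b
  proof -
    have sub: "subspace (range ((*v) A))"
      by (rule linear_subspace_image) auto
    obtain y z where y: "y \<in> span (range ((*v) A))"
      and z: "\<And>w. w \<in> span (range ((*v) A)) \<Longrightarrow> orthogonal z w" and b: "b = y + z"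
      by (rule orthogonal_subspace_decomp_exists[of "range ((*v) A)" b]) blast
    from y sub obtain x where x: "y = A *v x"
      by (metis imageE span_eq_iff)
    have "(transpose A *v z) \<bullet> v = 0" for v
      using z[of "A *v v"] span_base[of "A *v v" "range ((*v) A)"]
      by (simp add: orthogonal_def dot_lmul_matrix)
    then have "transpose A *v z = 0"
      using inner_eq_zero_iff by blast
    then show ?thesis
      using b x by (auto simp: matrix_vector_right_distrib)
  qed
  then obtain g where g: "\<And>b. transpose A *v (A *v g b) = transpose A *v b"
    by metis
  define X :: "real^'m^'n" where "X = (\<chi> i j. g (axis j 1) $ i)"
  have col: "column j X = g (axis j 1)" for j
    by (simp add: X_def column_def vec_eq_iff)
  have X: "X *v axis j 1 = g (axis j 1)" for j
    by (simp only: matrix_vector_mult_basis col)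
  have "(transpose A ** A ** X) *v axis j 1 = transpose A *v axis j 1" for j
    by (simp only: matrix_vector_mul_assoc[symmetric] X g)
  then have "column j (transpose A ** A ** X) = column j (transpose A)" for j
    by (simp only: matrix_vector_mult_basis)
  then have "transpose A ** A ** X = transpose A"
    by (simp add: column_def vec_eq_iff)
  then show thesis by (rule that)
qed

lemma transpose_mult_self_cancel:
  fixes A :: "real^'n^'m" and B C :: "real^'k^'n"
  assumes "transpose A ** A ** B = transpose A ** A ** C"
  shows "A ** B = A ** C"
proof -
  have "A *v (B *v x) = A *v (C *v x)" for x
  proof -
    define d where "d = B *v x - C *v x"
    have "transpose A *v (A *v (B *v x)) = transpose A *v (A *v (C *v x))"
      using assms by (simp add: matrix_vector_mul_assoc matrix_mul_assoc)
    then have "transpose A *v (A *v d) = 0"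
      by (simp add: d_def matrix_vector_mult_diff_distrib)
    then have "(transpose A *v (A *v d)) \<bullet> d = 0"
      by simp
    then have "A *v d = 0" by (simp add: dot_lmul_matrix)
    then show ?thesis by (simp add: d_def matrix_vector_mult_diff_distrib)
  qed
  then show ?thesis
    by (simp add: matrix_eq matrix_vector_mul_assoc)
qed

lemma exists_one_three_inverse:
  fixes A :: "real^'n^'m"
  obtains X :: "real^'m^'n" where "A ** X ** A = A" "transpose (A ** X) = A ** X"
proof -
  obtain X :: "real^'m^'n" where X: "transpose A ** A ** X = transpose A"
    by (rule normal_equations_solvable)
  have "transpose A ** A ** (X ** A) = transpose A ** A ** mat 1"
    using X by (simp add: matrix_mul_assoc)
  then have "A ** (X ** A) = A ** mat 1"
    by (rule transpose_mult_self_cancel)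
  then have "A ** X ** A = A"
    by (simp add: matrix_mul_assoc)
  moreover have s: "transpose (A ** X) ** (A ** X) = transpose (A ** X)"
    using X by (simp add: matrix_transpose_mul flip: matrix_mul_assoc)
  have "transpose (transpose (A ** X) ** (A ** X)) = transpose (A ** X) ** (A ** X)"
    by (simp add: matrix_transpose_mul)
  then have "transpose (A ** X) = A ** X"
    unfolding s by simp
  ultimately show thesis by (rule that)
qed

lemma moore_penrose_exists: "\<exists>X. moore_penrose A X"
proof -
  obtain X where X: "A ** X ** A = A" "transpose (A ** X) = A ** X"
    by (rule exists_one_three_inverse)
  obtain W where W: "transpose A ** W ** transpose A = transpose A"
      "transpose (transpose A ** W) = transpose A ** W"
    by (rule exists_one_three_inverse[of "transpose A"])
  define Y where "Y = transpose W"
  have Y1: "A ** Y ** A = A"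
    using arg_cong[OF W(1), of transpose]
    by (simp add: Y_def matrix_transpose_mul matrix_mul_assoc)
  have Y2: "transpose (Y ** A) = Y ** A"
    using W(2) by (simp add: Y_def matrix_transpose_mul)
  have l: "A ** (Y ** A ** X) = A ** X"
    using Y1 by (simp add: matrix_mul_assoc)
  have r: "Y ** A ** X ** A = Y ** A"
    using X(1) by (metis matrix_mul_assoc)
  have "moore_penrose A (Y ** A ** X)"
    unfolding moore_penrose_def l r
    using X Y1 Y2 by (metis l matrix_mul_assoc)
  then show ?thesis ..
qed

lemma moore_penrose_unique:
  assumes "moore_penrose A X" "moore_penrose A Y"
  shows "X = Y"
proof -
  note X = assms(1)[unfolded moore_penrose_def] and Y = assms(2)[unfolded moore_penrose_def]
  have "A ** X = transpose (A ** Y ** A ** X)"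
    using X Y by simp
  also have "\<dots> = transpose (A ** X) ** transpose (A ** Y)"
    by (metis matrix_transpose_mul matrix_mul_assoc)
  also have "\<dots> = A ** Y"
    using X Y by (simp add: matrix_mul_assoc)
  finally have AX: "A ** X = A ** Y" .
  have "X ** A = transpose (X ** (A ** Y ** A))"
    using X Y by simp
  also have "\<dots> = transpose (Y ** A) ** transpose (X ** A)"
    by (metis matrix_transpose_mul matrix_mul_assoc)
  also have "\<dots> = Y ** (A ** X ** A)"
    using X Y by (simp flip: matrix_mul_assoc)
  also have "\<dots> = Y ** A"
    using X by simp
  finally have XA: "X ** A = Y ** A" .
  have "X = Y ** A ** X" using X XA by metis
  also have "\<dots> = Y ** A ** Y" using AX by (metis matrix_mul_assoc)
  finally show ?thesis using Y by simp
qed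

lemma moore_penrose_pinv: "moore_penrose A (pinv A)"
  unfolding pinv_def
  using moore_penrose_exists[of A] moore_penrose_unique by (metis the_equality)

text \<open>In the next two definitions \<open>y\<close> and \<open>y'\<close> are the values, at one fixed time, of
  the observations and of their time derivative; \<open>w\<close> is a candidate value of the time
  derivative of the kernel component \<open>z\<close>.\<close>

definition reconstruction ::
  "real^'m^'N \<Rightarrow> real^'n^'N \<Rightarrow> real^'n \<Rightarrow> real^'m \<Rightarrow> real^'N" where
  "reconstruction \<Phi> S y z = (\<Phi> ** pinv (transpose S ** \<Phi>)) *v y + \<Phi> *v z"

definition residual_sq ::
  "real^'m^'N \<Rightarrow> real^'n^'N \<Rightarrow> (real^'N \<Rightarrow> real^'N) \<Rightarrow> real^'n \<Rightarrow> real^'n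
    \<Rightarrow> real^'m \<Rightarrow> real^'m \<Rightarrow> real" where
  "residual_sq \<Phi> S f y y' z w =
     (norm ((\<Phi> ** pinv (transpose S ** \<Phi>)) *v y' + \<Phi> *v w - f (reconstruction \<Phi> S y z)))\<^sup>2"

definition instantaneous_minimizer ::
  "real^'m^'N \<Rightarrow> real^'n^'N \<Rightarrow> (real^'N \<Rightarrow> real^'N) \<Rightarrow> real set \<Rightarrow> (real \<Rightarrow> real^'n)
    \<Rightarrow> real \<Rightarrow> real^'m \<Rightarrow> real^'m \<Rightarrow> bool" where
  "instantaneous_minimizer \<Phi> S f J y t z w \<longleftrightarrow>
     is_arg_min (residual_sq \<Phi> S f (y t) (vector_derivative y (at t within J)) z)
       (\<lambda>w. w \<in> null_space (transpose S ** \<Phi>)) w"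

definition optimal_path ::
  "real^'m^'N \<Rightarrow> real^'n^'N \<Rightarrow> (real^'N \<Rightarrow> real^'N) \<Rightarrow> real set \<Rightarrow> (real \<Rightarrow> real^'n)
    \<Rightarrow> (real \<Rightarrow> real^'m) \<Rightarrow> bool" where
  "optimal_path \<Phi> S f J y z \<longleftrightarrow>
     (\<forall>t\<in>J. z t \<in> null_space (transpose S ** \<Phi>) \<and>
        z differentiable (at t within J) \<and>
        instantaneous_minimizer \<Phi> S f J y t (z t) (vector_derivative z (at t within J)))"

definition latent_velocity ::
  "real^'m^'N \<Rightarrow> real^'n^'N \<Rightarrow> real^'k^'m \<Rightarrow> (real^'N \<Rightarrow> real^'N) \<Rightarrow> real^'n
    \<Rightarrow> real^'k \<Rightarrow> real^'k" where
  "latent_velocity \<Phi> S Z f y \<xi> =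
     transpose Z *v (transpose \<Phi> *v f (reconstruction \<Phi> S y (Z *v \<xi>)))"

end

theory Submission
  imports Defs
begin

text \<open>
  The instantaneous problem is a linear least-squares problem on a subspace. Write
  \<open>A = S\<^sup>T\<Phi>\<close>. The range of \<open>A\<^sup>+\<close> is orthogonal to the null space of \<open>A\<close>, and \<open>\<Phi>\<close> is an
  isometry, so \<open>\<Phi>A\<^sup>+y'\<close> is orthogonal to every admissible \<open>\<Phi>w\<close>: the observed velocity
  drops out of the normal equations. What remains is to project \<open>f\<close>, evaluated at the
  reconstruction, orthogonally onto the range of \<open>\<Phi>Z\<close>, whose columns are orthonormal; this gives
  \<open>w\<^sub>0 = ZZ\<^sup>T\<Phi>\<^sup>Tf\<close>. Pythagoras shows that any other admissible \<open>w\<close> increases the residual by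
  exactly \<open>\<parallel>w - w\<^sub>0\<parallel>\<^sup>2\<close> (\<open>residual_sq_pythagoras\<close>), hence existence and uniqueness of
  the minimizer. Since \<open>Z\<^sup>TZ = 1\<close> and the range of \<open>Z\<close> is the null space of \<open>A\<close>, the
  substitution \<open>z = Z\<xi>\<close>, \<open>\<xi> = Z\<^sup>Tz\<close> translates optimal paths into solutions of the differential
  equation for \<open>\<xi>\<close> and back (\<open>optimal_path_iff\<close>).

  It remains to solve that equation on all of \<open>J\<close>, uniquely for each initial value. Its right-hand
  side depends on time through \<open>y\<close>, and \<open>u\<close> may be given on a half-open interval only. Both
  difficulties disappear when \<open>\<xi>\<close> is solved together with \<open>u\<close>: the pair satisfies an autonomous
  equation with a globally Lipschitz field (\<open>coupled_field_lipschitz\<close>), which has a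
  solution on the whole half-line (\<open>lipschitz_ode_global_solution\<close>). By uniqueness
  (\<open>lipschitz_ode_unique\<close>), its first component is \<open>u\<close> on \<open>J\<close>, so its second component solves the
  equation for \<open>\<xi>\<close>; uniqueness for the pair gives uniqueness of \<open>\<xi>\<close>.
\<close>

section \<open>Globally Lipschitz autonomous differential equations\<close>

lemma integral_has_vector_derivative_halfline:
  fixes h :: "real \<Rightarrow> 'a::banach"
  assumes "continuous_on {0..} h" and "t \<ge> 0"
  shows "((\<lambda>t. integral {0..t} h) has_vector_derivative h t) (at t within {0..})"
proof -
  have "((\<lambda>t. integral {0..t} h) has_vector_derivative h t) (at t within {0..t+1})"
    using assms by (intro integral_has_vector_derivative) (auto elim: continuous_on_subset)
  moreover have "at t within {0..t+1} = at t within {0..}"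
    by (rule at_within_nhd[of t "{..<t+1}"]) auto
  ultimately show ?thesis by simp
qed

text \<open>
  The gain \<open>1 / a\<close> does not depend on \<open>t\<close>. This makes the Picard operator a contraction on
  the whole half-line at once, provided that the exponent \<open>a\<close> exceeds the Lipschitz constant.
\<close>

lemma exp_weighted_integral_bound:
  fixes h :: "real \<Rightarrow> 'a::banach"
  assumes "a > 0" and "t \<ge> 0" and "continuous_on {0..t} h"
    and bound: "\<And>s. s \<in> {0..t} \<Longrightarrow> norm (h s) \<le> C * exp (a * s)"
  shows "norm (exp (- a * t) *\<^sub>R integral {0..t} h) \<le> C / a"
proof -
  have "0 \<le> C"
    using bound[of 0] \<open>t \<ge> 0\<close> order_trans[OF norm_ge_zero] by fastforce
  have I: "((\<lambda>s. C * exp (a * s)) has_integral (C / a * exp (a * t) - C / a * exp (a * 0))) {0..t}"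
    using \<open>a > 0\<close> \<open>t \<ge> 0\<close>
    by (intro fundamental_theorem_of_calculus)
       (auto intro!: derivative_eq_intros simp flip: has_real_derivative_iff_has_vector_derivative)
  have "norm (integral {0..t} h) \<le> integral {0..t} (\<lambda>s. C * exp (a * s))"
    using I assms
    by (intro integral_norm_bound_integral integrable_continuous_real)
       (auto simp: has_integral_iff intro!: integrable_continuous_real continuous_intros)
  also have "\<dots> \<le> C / a * exp (a * t)"
    using I \<open>a > 0\<close> \<open>0 \<le> C\<close> by (simp add: has_integral_iff)
  finally have "exp (- a * t) * norm (integral {0..t} h) \<le> exp (- a * t) * (C / a * exp (a * t))"
    by (intro mult_left_mono) auto
  also have "\<dots> = C / a"
    by (simp add: exp_minus)
  finally show ?thesis by simp
qed

text \<open>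
  Banach's fixed-point theorem in the weighted supremum norm of Bielecki: the unknown is
  \<open>v(t) = exp(-at) x(t)\<close>, which stays bounded because \<open>x\<close> grows at most exponentially, so that
  no continuation from short time intervals is needed.
\<close>

lemma lipschitz_ode_global_solution:
  fixes F :: "'a::banach \<Rightarrow> 'a"
  assumes "L-lipschitz_on UNIV F"
  obtains x where "x 0 = x0"
    and "\<And>t. t \<ge> 0 \<Longrightarrow> (x has_vector_derivative F (x t)) (at t within {0..})"
proof -
  \<comment> \<open>\<open>L\<close> may be zero, but the weight needs a positive rate; \<open>a = 2 * K\<close> gives the
    contraction factor \<open>K / a = 1 / 2\<close>.\<close>
  define K where "K = L + 1"
  define a where "a = 2 * K"
  have K: "K > 0" and F: "K-lipschitz_on UNIV F"
    using lipschitz_on_nonneg[OF assms] lipschitz_on_mono[OF assms] by (auto simp: K_def)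
  then have a: "a > 0" by (simp add: a_def)
  note contF = continuous_on_compose2[OF lipschitz_on_continuous_on[OF F], simplified]
  define X :: "(real \<Rightarrow>\<^sub>C 'a) \<Rightarrow> real \<Rightarrow> 'a" where "X v s = exp (a * s) *\<^sub>R v s" for v s
  have contX: "continuous_on A (X v)" for v A
    unfolding X_def by (intro continuous_intros) auto
  have contFX: "continuous_on A (\<lambda>s. F (X v s))" for v A
    by (intro contF contX)
  \<comment> \<open>Bounded continuous functions are total on the reals, so the Picard operator
    is extended to negative times by its value at \<open>0\<close>.\<close>
  define T where
    "T v t = exp (- a * max 0 t) *\<^sub>R (x0 + integral {0..max 0 t} (\<lambda>s. F (X v s)))"
    for v t
  have T: "T v \<in> bcontfun" for v
  proof (rule bcontfun_normI)
    have "continuous_on {0..} (\<lambda>t. integral {0..t} (\<lambda>s. F (X v s)))"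
      using integral_has_vector_derivative_halfline[OF contFX]
      by (force simp: continuous_on_eq_continuous_within intro: has_vector_derivative_continuous)
    then have "continuous_on UNIV (\<lambda>t. integral {0..max 0 t} (\<lambda>s. F (X v s)))"
      by (rule continuous_on_compose2) (auto intro!: continuous_intros)
    then show "continuous_on UNIV (T v)"
      unfolding T_def by (intro continuous_intros)
    fix t
    have growth: "norm (F (X v s)) \<le> (norm (F 0) + K * norm v) * exp (a * s)" if "s \<in> {0..max 0 t}" for s
    proof -
      have "norm (F (X v s)) \<le> norm (F 0) + norm (F (X v s) - F 0)"
        by (metis add.commute norm_triangle_sub)
      also have "norm (F (X v s) - F 0) \<le> K * norm (X v s - 0)"
        by (rule lipschitz_on_normD[OF F]) auto
      also have "\<dots> \<le> K * (exp (a * s) * norm v)"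
        using K norm_bounded[of v s] by (simp add: X_def)
      also have "norm (F 0) \<le> norm (F 0) * exp (a * s)"
        using that a by (simp add: mult_le_cancel_left1)
      finally show ?thesis by (simp add: algebra_simps)
    qed
    have "norm (T v t) \<le> norm (exp (- a * max 0 t) *\<^sub>R x0)
        + norm (exp (- a * max 0 t) *\<^sub>R integral {0..max 0 t} (\<lambda>s. F (X v s)))"
      unfolding T_def scaleR_add_right by (rule norm_triangle_ineq)
    also have "\<dots> \<le> norm x0 + (norm (F 0) + K * norm v) / a"
      using a growth contFX
      by (intro add_mono exp_weighted_integral_bound) (auto simp: mult_left_le_one_le)
    finally show "norm (T v t) \<le> norm x0 + (norm (F 0) + K * norm v) / a" .
  qed
  have contraction: "dist (Bcontfun (T v)) (Bcontfun (T w)) \<le> 1/2 * dist v w" for v w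
  proof (rule dist_bound)
    fix t
    have int: "(\<lambda>s. F (X v s)) integrable_on {0..max 0 t}" for v
      by (intro integrable_continuous_real contFX)
    have gap: "norm (F (X v s) - F (X w s)) \<le> K * dist v w * exp (a * s)" for s
    proof -
      have "norm (F (X v s) - F (X w s)) \<le> K * norm (X v s - X w s)"
        by (rule lipschitz_on_normD[OF F]) auto
      also have "\<dots> = K * (exp (a * s) * dist (v s) (w s))"
        by (simp add: X_def dist_norm flip: scaleR_diff_right)
      also have "\<dots> \<le> K * (exp (a * s) * dist v w)"
        using K dist_bounded[of v s w] by simp
      finally show ?thesis by (simp add: algebra_simps)
    qed
    have "dist (T v t) (T w t) =
        norm (exp (- a * max 0 t) *\<^sub>R integral {0..max 0 t} (\<lambda>s. F (X v s) - F (X w s)))"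
      by (simp add: T_def dist_norm Henstock_Kurzweil_Integration.integral_diff int
          flip: scaleR_diff_right)
    also have "\<dots> \<le> K * dist v w / a"
      using a gap by (intro exp_weighted_integral_bound continuous_intros contFX) auto
    finally show "dist (Bcontfun (T v) t) (Bcontfun (T w) t) \<le> 1/2 * dist v w"
      using K by (simp add: Bcontfun_inverse T a_def)
  qed
  obtain v where "Bcontfun (T v) = v"
    using banach_fix_type[of "1/2" "\<lambda>v. Bcontfun (T v)"] contraction by auto
  then have v: "v t = T v t" for t
    by (metis Bcontfun_inverse T)
  have X: "X v t = x0 + integral {0..t} (\<lambda>s. F (X v s))" if "t \<ge> 0" for t
    using v[of t] that by (simp add: X_def[of v t] T_def exp_minus)
  show thesis
  proof
    show "X v 0 = x0" by (simp add: X)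
    fix t :: real assume "t \<ge> 0"
    have "((\<lambda>t. x0 + integral {0..t} (\<lambda>s. F (X v s))) has_vector_derivative 0 + F (X v t))
        (at t within {0..})"
      using \<open>t \<ge> 0\<close> contFX
      by (intro has_vector_derivative_add integral_has_vector_derivative_halfline
          has_vector_derivative_const)
    then show "(X v has_vector_derivative F (X v t)) (at t within {0..})"
      using \<open>t \<ge> 0\<close> has_vector_derivative_transform[of t "{0..}" "X v", OF _ X] by simp
  qed
qed

text \<open>
  A Gronwall argument: by the Lipschitz bound and the Cauchy-Schwarz inequality,
  \<open>exp(-2Lt) \<parallel>x(t) - x'(t)\<parallel>\<^sup>2\<close> cannot increase, and it starts at \<open>0\<close>.
\<close>

lemma lipschitz_ode_unique:
  fixes F :: "'a::real_inner \<Rightarrow> 'a"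
  assumes F: "L-lipschitz_on UNIV F" and J: "is_interval J" "0 \<in> J" "J \<subseteq> {0..}"
    and x: "\<And>t. t \<in> J \<Longrightarrow> (x has_vector_derivative F (x t)) (at t within J)"
    and x': "\<And>t. t \<in> J \<Longrightarrow> (x' has_vector_derivative F (x' t)) (at t within J)"
    and "x 0 = x' 0" and "t \<in> J"
  shows "x t = x' t"
proof (cases "t = 0")
  case False
  then have "0 < t" using J \<open>t \<in> J\<close> by force
  have sub: "{0..t} \<subseteq> J"
    using J(1,2) \<open>t \<in> J\<close> mem_is_interval_1_I[of J 0 t] by auto
  define d where "d s = x s - x' s" for s
  define \<phi> where "\<phi> s = exp (- 2 * L * s) * (d s \<bullet> d s)" for s
  define \<phi>' where "\<phi>' s = 2 * exp (- 2 * L * s) * (d s \<bullet> (F (x s) - F (x' s)) - L * (d s \<bullet> d s))" for s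
  have "(\<phi> has_derivative (\<lambda>h. h * \<phi>' s)) (at s within {0..t})" if "0 \<le> s" "s \<le> t" for s
  proof -
    have "s \<in> J" using sub that by auto
    then have "(d has_vector_derivative F (x s) - F (x' s)) (at s within {0..t})"
      unfolding d_def
      by (intro has_vector_derivative_diff has_vector_derivative_within_subset[OF _ sub] x x')
    then show ?thesis
      unfolding \<phi>_def \<phi>'_def has_vector_derivative_def
      by (auto intro!: derivative_eq_intros simp: algebra_simps inner_commute fun_eq_iff)
  qed
  from mvt_simple[OF \<open>0 < t\<close> this]
  obtain s where "\<phi> t - \<phi> 0 = t * \<phi>' s" by auto
  moreover have "\<phi>' s \<le> 0"
  proof -
    have "d s \<bullet> (F (x s) - F (x' s)) \<le> norm (d s) * norm (F (x s) - F (x' s))"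
      by (rule norm_cauchy_schwarz)
    also have "\<dots> \<le> norm (d s) * (L * norm (d s))"
      unfolding d_def using lipschitz_on_normD[OF F] by (intro mult_left_mono) auto
    also have "\<dots> = L * (d s \<bullet> d s)"
      by (simp add: dot_square_norm power2_eq_square)
    finally show ?thesis
      by (simp add: \<phi>'_def mult_nonneg_nonpos)
  qed
  moreover have "\<phi> 0 = 0" by (simp add: \<phi>_def d_def assms)
  ultimately have "\<phi> t \<le> 0"
    using \<open>0 < t\<close> by (simp add: mult_nonneg_nonpos)
  then have "d t \<bullet> d t \<le> 0"
    by (simp add: \<phi>_def mult_le_0_iff)
  then have "d t = 0"
    by (simp add: dot_square_norm)
  then show ?thesis by (simp add: d_def)
qed (use assms in simp)

section \<open>The residual on the kernel of the sampled basis\<close>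

text \<open>
  The default rewriting of \<open>transpose A *v x\<close> to \<open>x v* A\<close> would hide the adjoints that the
  following computations move across inner products.
\<close>

declare transpose_matrix_vector [simp del]

lemma inner_matrix_vector_transpose:
  fixes A :: "real^'n^'m"
  shows "(A *v x) \<bullet> y = x \<bullet> (transpose A *v y)"
  by (metis dot_lmul_matrix inner_commute transpose_matrix_vector)

lemma basis_matrix_inner:
  assumes "basis_matrix \<Phi>"
  shows "(\<Phi> *v x) \<bullet> (\<Phi> *v y) = x \<bullet> y"
  using assms by (simp add: inner_matrix_vector_transpose basis_matrix_def matrix_vector_mul_assoc)

lemma kernel_matrix_transpose_mult:
  assumes "kernel_matrix A Z"
  shows "transpose Z ** Z = mat 1"
  using assms
  by (simp add: kernel_matrix_def vec_eq_iff matrix_mult_transpose_dot_column mat_def)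

lemma kernel_matrix_left_inverse:
  assumes "kernel_matrix A Z"
  shows "transpose Z *v (Z *v \<xi>) = \<xi>"
  using kernel_matrix_transpose_mult[OF assms] by (simp add: matrix_vector_mul_assoc)

lemma kernel_matrix_range:
  fixes Z :: "real^'k^'m"
  assumes "kernel_matrix A Z"
  shows "null_space A = range ((*v) Z)"
proof -
  have "span (columns Z) = (*v) Z ` span (range (\<lambda>i. axis i 1))"
    unfolding columns_image_basis by (simp add: linear_span_image)
  also have "range (\<lambda>i. axis i 1) = (Basis :: (real^'k) set)"
    by (auto simp: Basis_vec_def)
  finally show ?thesis
    using assms by (simp add: kernel_matrix_def)
qed

text \<open>
  \<open>A\<^sup>+A\<close> is symmetric, fixes the range of \<open>A\<^sup>+\<close>, and vanishes on the null space of \<open>A\<close>.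
\<close>

lemma pinv_orthogonal_null_space:
  assumes "w \<in> null_space A"
  shows "w \<bullet> (pinv A *v b) = 0"
proof -
  have P: "pinv A ** A ** pinv A = pinv A" "transpose (pinv A ** A) = pinv A ** A"
    using moore_penrose_pinv[of A] by (auto simp: moore_penrose_def)
  have "pinv A *v b = (pinv A ** A) *v (pinv A *v b)"
    using P(1) by (simp add: matrix_vector_mul_assoc)
  then have "w \<bullet> (pinv A *v b) = ((pinv A ** A) *v w) \<bullet> (pinv A *v b)"
    using P(2) by (metis inner_matrix_vector_transpose)
  also have "(pinv A ** A) *v w = 0"
    using assms by (simp add: null_space_def flip: matrix_vector_mul_assoc)
  finally show ?thesis by simp
qed

text \<open>
  The residual vector at \<open>w\<^sub>0\<close> is orthogonal to all \<open>\<Phi>Z\<delta>\<close>: the term from \<open>y'\<close> drops out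
  by \<open>pinv_orthogonal_null_space\<close>, and \<open>w\<^sub>0\<close> is chosen so that the other two terms cancel.
\<close>

lemma residual_sq_pythagoras:
  fixes \<Phi> :: "real^'m^'N" and S :: "real^'n^'N" and Z :: "real^'k^'m"
    and f :: "real^'N \<Rightarrow> real^'N" and y :: "real^'n" and z :: "real^'m"
  assumes \<Phi>: "basis_matrix \<Phi>" and Z: "kernel_matrix (transpose S ** \<Phi>) Z"
    and w: "w \<in> null_space (transpose S ** \<Phi>)"
  defines "w\<^sub>0 \<equiv> Z *v (transpose Z *v (transpose \<Phi> *v f (reconstruction \<Phi> S y z)))"
  shows "residual_sq \<Phi> S f y y' z w = residual_sq \<Phi> S f y y' z w\<^sub>0 + (norm (w - w\<^sub>0))\<^sup>2"
proof -
  define P where "P = pinv (transpose S ** \<Phi>)"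
  define v where "v = f (reconstruction \<Phi> S y z)"
  define r where "r = (\<Phi> ** P) *v y' + \<Phi> *v w\<^sub>0 - v"
  obtain \<eta> where \<eta>: "w = Z *v \<eta>"
    using w kernel_matrix_range[OF Z] by auto
  define \<delta> where "\<delta> = \<eta> - transpose Z *v (transpose \<Phi> *v v)"
  have \<delta>: "w - w\<^sub>0 = Z *v \<delta>"
    by (simp add: \<eta> w\<^sub>0_def \<delta>_def v_def matrix_vector_mult_diff_distrib)
  have null: "Z *v \<delta> \<in> null_space (transpose S ** \<Phi>)"
    using kernel_matrix_range[OF Z] by auto
  have "r \<bullet> (\<Phi> *v (Z *v \<delta>)) =
      (P *v y') \<bullet> (Z *v \<delta>) + w\<^sub>0 \<bullet> (Z *v \<delta>) - v \<bullet> (\<Phi> *v (Z *v \<delta>))"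
    by (simp add: r_def inner_add_left inner_diff_left basis_matrix_inner[OF \<Phi>]
        flip: matrix_vector_mul_assoc)
  also have "(P *v y') \<bullet> (Z *v \<delta>) = 0"
    using pinv_orthogonal_null_space[OF null] by (simp add: P_def inner_commute)
  also have "w\<^sub>0 \<bullet> (Z *v \<delta>) = (transpose Z *v (transpose \<Phi> *v v)) \<bullet> \<delta>"
    by (simp add: w\<^sub>0_def v_def inner_matrix_vector_transpose kernel_matrix_left_inverse[OF Z])
  also have "v \<bullet> (\<Phi> *v (Z *v \<delta>)) = (transpose Z *v (transpose \<Phi> *v v)) \<bullet> \<delta>"
    by (metis inner_matrix_vector_transpose inner_commute)
  finally have orth: "orthogonal r (\<Phi> *v (Z *v \<delta>))"
    by (simp add: orthogonal_def)
  have split: "(\<Phi> ** P) *v y' + \<Phi> *v w - v = r + \<Phi> *v (Z *v \<delta>)"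
    by (simp add: r_def matrix_vector_mult_diff_distrib flip: \<delta>)
  have isometry: "norm (\<Phi> *v (Z *v \<delta>)) = norm (Z *v \<delta>)"
    by (simp add: norm_eq_sqrt_inner basis_matrix_inner[OF \<Phi>])
  show ?thesis
    by (simp only: residual_sq_def \<delta> split norm_add_Pythagorean[OF orth] isometry
        flip: P_def v_def r_def)
qed

lemma instantaneous_minimizer_iff:
  fixes \<Phi> :: "real^'m^'N" and S :: "real^'n^'N" and Z :: "real^'k^'m"
  assumes \<Phi>: "basis_matrix \<Phi>" and Z: "kernel_matrix (transpose S ** \<Phi>) Z"
  shows "instantaneous_minimizer \<Phi> S f J y t (Z *v \<xi>) w \<longleftrightarrow>
    w = Z *v latent_velocity \<Phi> S Z f (y t) \<xi>"
proof -
  define w\<^sub>0 where "w\<^sub>0 = Z *v latent_velocity \<Phi> S Z f (y t) \<xi>"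
  define R where "R = residual_sq \<Phi> S f (y t) (vector_derivative y (at t within J)) (Z *v \<xi>)"
  have null: "w\<^sub>0 \<in> null_space (transpose S ** \<Phi>)"
    using kernel_matrix_range[OF Z] by (auto simp: w\<^sub>0_def)
  have R: "R w = R w\<^sub>0 + (norm (w - w\<^sub>0))\<^sup>2" if "w \<in> null_space (transpose S ** \<Phi>)" for w
    unfolding R_def w\<^sub>0_def latent_velocity_def by (rule residual_sq_pythagoras[OF \<Phi> Z that])
  have "is_arg_min R (\<lambda>w. w \<in> null_space (transpose S ** \<Phi>)) w \<longleftrightarrow> w = w\<^sub>0"
  proof
    assume "is_arg_min R (\<lambda>w. w \<in> null_space (transpose S ** \<Phi>)) w"
    then have "w \<in> null_space (transpose S ** \<Phi>)" "\<not> R w\<^sub>0 < R w"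
      using null by (auto simp: is_arg_min_def)
    then show "w = w\<^sub>0" using R[of w] by simp
  next
    assume "w = w\<^sub>0"
    then show "is_arg_min R (\<lambda>w. w \<in> null_space (transpose S ** \<Phi>)) w"
      using null R unfolding is_arg_min_linorder by (metis le_add_same_cancel1 zero_le_power2)
  qed
  then show ?thesis
    by (simp add: instantaneous_minimizer_def R_def w\<^sub>0_def)
qed

section \<open>Optimal paths\<close>

lemma has_vector_derivative_matrix_vector_mult:
  fixes A :: "real^'n^'m"
  assumes "(x has_vector_derivative x') F"
  shows "((\<lambda>t. A *v x t) has_vector_derivative A *v x') F"
  by (rule bounded_linear.has_vector_derivative[OF matrix_vector_mul_bounded_linear assms])

text \<open>
  The premise on \<open>J\<close> excludes isolated times, at which derivatives within \<open>J\<close> would not be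
  unique.
\<close>

lemma optimal_path_iff:
  fixes \<Phi> :: "real^'m^'N" and S :: "real^'n^'N" and Z :: "real^'k^'m"
  assumes \<Phi>: "basis_matrix \<Phi>" and Z: "kernel_matrix (transpose S ** \<Phi>) Z"
    and lim: "\<And>t. t \<in> J \<Longrightarrow> at t within J \<noteq> bot"
  shows "optimal_path \<Phi> S f J y z \<longleftrightarrow>
    (\<exists>\<xi>. \<forall>t\<in>J. z t = Z *v \<xi> t \<and>
      (\<xi> has_vector_derivative latent_velocity \<Phi> S Z f (y t) (\<xi> t)) (at t within J))"
proof
  assume opt: "optimal_path \<Phi> S f J y z"
  define \<xi> where "\<xi> t = transpose Z *v z t" for t
  have z: "z t = Z *v \<xi> t" if "t \<in> J" for t
    using opt that kernel_matrix_range[OF Z] kernel_matrix_left_inverse[OF Z]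
    by (auto simp: optimal_path_def \<xi>_def)
  have "(\<xi> has_vector_derivative latent_velocity \<Phi> S Z f (y t) (\<xi> t)) (at t within J)"
    if "t \<in> J" for t
  proof -
    have "z differentiable (at t within J)"
      and "instantaneous_minimizer \<Phi> S f J y t (Z *v \<xi> t) (vector_derivative z (at t within J))"
      using opt that z[OF that] by (auto simp: optimal_path_def)
    then have "(z has_vector_derivative Z *v latent_velocity \<Phi> S Z f (y t) (\<xi> t)) (at t within J)"
      by (metis instantaneous_minimizer_iff[OF \<Phi> Z] vector_derivative_works)
    from has_vector_derivative_matrix_vector_mult[OF this, of "transpose Z"]
    show ?thesis by (simp add: \<xi>_def[abs_def] kernel_matrix_left_inverse[OF Z])
  qed
  with z show "\<exists>\<xi>. \<forall>t\<in>J. z t = Z *v \<xi> t \<and>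
      (\<xi> has_vector_derivative latent_velocity \<Phi> S Z f (y t) (\<xi> t)) (at t within J)"
    by blast
next
  assume "\<exists>\<xi>. \<forall>t\<in>J. z t = Z *v \<xi> t \<and>
      (\<xi> has_vector_derivative latent_velocity \<Phi> S Z f (y t) (\<xi> t)) (at t within J)"
  then obtain \<xi> where z: "\<And>t. t \<in> J \<Longrightarrow> z t = Z *v \<xi> t"
    and \<xi>: "\<And>t. t \<in> J \<Longrightarrow>
      (\<xi> has_vector_derivative latent_velocity \<Phi> S Z f (y t) (\<xi> t)) (at t within J)"
    by blast
  show "optimal_path \<Phi> S f J y z"
    unfolding optimal_path_def
  proof (intro ballI conjI)
    fix t assume t: "t \<in> J"
    show "z t \<in> null_space (transpose S ** \<Phi>)"
      using z[OF t] kernel_matrix_range[OF Z] by auto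
    have D: "(z has_vector_derivative Z *v latent_velocity \<Phi> S Z f (y t) (\<xi> t)) (at t within J)"
      using has_vector_derivative_transform[OF t z has_vector_derivative_matrix_vector_mult[OF \<xi>[OF t]]]
      by simp
    then show "z differentiable (at t within J)"
      by (rule differentiableI_vector)
    show "instantaneous_minimizer \<Phi> S f J y t (z t) (vector_derivative z (at t within J))"
      unfolding vector_derivative_within[OF lim[OF t] D] z[OF t]
      by (simp add: instantaneous_minimizer_iff[OF \<Phi> Z])
  qed
qed

lemma reconstruction_has_vector_derivative:
  assumes "(y has_vector_derivative y') F" and "(z has_vector_derivative z') F"
  shows "((\<lambda>s. reconstruction \<Phi> S (y s) (z s)) has_vector_derivative
    (\<Phi> ** pinv (transpose S ** \<Phi>)) *v y' + \<Phi> *v z') F"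
  unfolding reconstruction_def
  by (intro has_vector_derivative_add has_vector_derivative_matrix_vector_mult assms)

text \<open>
  Carrying the full state \<open>u\<close> along with \<open>\<xi>\<close> replaces the time-dependent input \<open>y\<close> by
  \<open>S\<^sup>Tu\<close> and thereby makes the equation for \<open>\<xi>\<close> autonomous.
\<close>

definition coupled_field ::
  "real^'m^'N \<Rightarrow> real^'n^'N \<Rightarrow> real^'k^'m \<Rightarrow> (real^'N \<Rightarrow> real^'N)
    \<Rightarrow> (real^'N) \<times> (real^'k) \<Rightarrow> (real^'N) \<times> (real^'k)" where
  "coupled_field \<Phi> S Z f p =
     (f (fst p), latent_velocity \<Phi> S Z f (transpose S *v fst p) (snd p))"

lemma bounded_linear_lipschitz:
  assumes "bounded_linear h"
  shows "\<exists>L. L-lipschitz_on UNIV h"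
  using bounded_linear.lipschitz_boundE[OF assms] by metis

lemma coupled_field_lipschitz:
  fixes \<Phi> :: "real^'m^'N" and S :: "real^'n^'N" and Z :: "real^'k^'m"
  assumes "\<exists>L. L-lipschitz_on UNIV f"
  shows "\<exists>L. L-lipschitz_on UNIV (coupled_field \<Phi> S Z f)"
proof -
  define R where "R p = reconstruction \<Phi> S (transpose S *v fst p) (Z *v snd p)" for p
  define Q where "Q v = transpose Z *v (transpose \<Phi> *v v)" for v
  have "bounded_linear R"
    unfolding R_def[abs_def] reconstruction_def
    by (intro bounded_linear_add
        bounded_linear_compose[OF matrix_vector_mul_bounded_linear]
        bounded_linear_fst bounded_linear_snd)
  then obtain LR where R: "LR-lipschitz_on UNIV R"
    using bounded_linear_lipschitz by blast
  have "bounded_linear Q"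
    unfolding Q_def[abs_def]
    by (intro bounded_linear_compose[OF matrix_vector_mul_bounded_linear]
        matrix_vector_mul_bounded_linear)
  then obtain LQ where Q: "LQ-lipschitz_on UNIV Q"
    using bounded_linear_lipschitz by blast
  obtain L1 where fst: "L1-lipschitz_on UNIV (fst :: (real^'N) \<times> (real^'k) \<Rightarrow> _)"
    using bounded_linear_lipschitz[OF bounded_linear_fst] by blast
  obtain Lf where f: "Lf-lipschitz_on UNIV f" using assms by blast
  \<comment> \<open>The composition rule asks for Lipschitz bounds on the images of the inner maps.\<close>
  have f': "Lf-lipschitz_on A f" and Q': "LQ-lipschitz_on B Q" for A B
    using f Q by (auto intro: lipschitz_on_subset)
  have "\<exists>L. L-lipschitz_on UNIV (\<lambda>p. (f (fst p), Q (f (R p))))"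
    using lipschitz_on_Pair[OF lipschitz_on_compose2[OF fst f']
        lipschitz_on_compose2[OF lipschitz_on_compose2[OF R f'] Q']] by blast
  moreover have "coupled_field \<Phi> S Z f = (\<lambda>p. (f (fst p), Q (f (R p))))"
    by (simp add: fun_eq_iff coupled_field_def latent_velocity_def R_def Q_def)
  ultimately show ?thesis by metis
qed

lemma coupled_field_solution:
  assumes "t \<in> J" and "y t = transpose S *v u t"
    and "(u has_vector_derivative f (u t)) (at t within J)"
    and "(\<xi> has_vector_derivative latent_velocity \<Phi> S Z f (y t) (\<xi> t)) (at t within J)"
  shows "((\<lambda>t. (u t, \<xi> t)) has_vector_derivative coupled_field \<Phi> S Z f (u t, \<xi> t)) (at t within J)"
  using assms by (auto simp: coupled_field_def intro!: has_vector_derivative_Pair)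


theorem theorem3:
  fixes \<Phi> :: "real^'m^'N" and S :: "real^'n^'N" and Z :: "real^'k^'m"
    and f :: "real^'N \<Rightarrow> real^'N" and u :: "real \<Rightarrow> real^'N" and u0 :: "real^'N"
    and y :: "real \<Rightarrow> real^'n" and J :: "real set"
  assumes "CARD('n) < CARD('m)" and "CARD('m) \<le> CARD('N)" and "CARD('k) = CARD('m) - CARD('n)"
    and "basis_matrix \<Phi>" and "selection_matrix S"
    and "rank (transpose S ** \<Phi>) = CARD('n)"
    and "kernel_matrix (transpose S ** \<Phi>) Z"
    and "\<exists>L. L-lipschitz_on UNIV f"
    and "is_interval J" and "0 \<in> J" and "J \<subseteq> {0..}" and "J \<noteq> {0}"
    and "\<And>t. t \<in> J \<Longrightarrow> (u has_vector_derivative f (u t)) (at t within J)" and "u 0 = u0"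
    and "\<And>t. t \<in> J \<Longrightarrow> y t = transpose S *v u t"
  shows
    "(\<forall>z t. (\<forall>s\<in>J. z s \<in> null_space (transpose S ** \<Phi>)) \<longrightarrow> t \<in> J \<longrightarrow>
        z differentiable (at t within J) \<longrightarrow>
        ((\<lambda>s. reconstruction \<Phi> S (y s) (z s)) has_vector_derivative
          (\<Phi> ** pinv (transpose S ** \<Phi>)) *v vector_derivative y (at t within J)
            + \<Phi> *v vector_derivative z (at t within J)) (at t within J)) \<and>
     (\<forall>t\<in>J. \<forall>z\<in>null_space (transpose S ** \<Phi>).
        \<exists>!w. instantaneous_minimizer \<Phi> S f J y t z w) \<and>
     (\<forall>t\<in>J. \<forall>\<xi>. instantaneous_minimizer \<Phi> S f J y t (Z *v \<xi>)
        (Z *v latent_velocity \<Phi> S Z f (y t) \<xi>)) \<and>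
     (\<forall>z. optimal_path \<Phi> S f J y z \<longleftrightarrow>
        (\<exists>\<xi>. \<forall>t\<in>J. z t = Z *v \<xi> t \<and>
          (\<xi> has_vector_derivative latent_velocity \<Phi> S Z f (y t) (\<xi> t)) (at t within J))) \<and>
     (\<forall>z0\<in>null_space (transpose S ** \<Phi>).
        \<exists>z. optimal_path \<Phi> S f J y z \<and> z 0 = z0 \<and>
          (\<forall>z'. optimal_path \<Phi> S f J y z' \<and> z' 0 = z0 \<longrightarrow> (\<forall>t\<in>J. z' t = z t)))"
proof -
  let ?A = "transpose S ** \<Phi>"
  note \<Phi> = \<open>basis_matrix \<Phi>\<close> and Z = \<open>kernel_matrix ?A Z\<close>
    and J = \<open>is_interval J\<close> \<open>0 \<in> J\<close> \<open>J \<subseteq> {0..}\<close>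
    and u = assms(13) and y = assms(15)
  note minimizer = instantaneous_minimizer_iff[OF \<Phi> Z]
  have lim: "at t within J \<noteq> bot" if "t \<in> J" for t
  proof -
    have "J \<noteq> {x}" for x
      using \<open>0 \<in> J\<close> \<open>J \<noteq> {0}\<close> by auto
    with connected_imp_perfect[OF is_interval_connected[OF J(1)] that]
    show ?thesis by (simp add: trivial_limit_within)
  qed
  have path: "optimal_path \<Phi> S f J y z \<longleftrightarrow>
      (\<exists>\<xi>. \<forall>t\<in>J. z t = Z *v \<xi> t \<and>
        (\<xi> has_vector_derivative latent_velocity \<Phi> S Z f (y t) (\<xi> t)) (at t within J))" for z
    by (rule optimal_path_iff[OF \<Phi> Z lim])
  have y': "(y has_vector_derivative vector_derivative y (at t within J)) (at t within J)"
    if "t \<in> J" for t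
    using has_vector_derivative_transform[OF that y
        has_vector_derivative_matrix_vector_mult[OF u[OF that]]]
    by (metis differentiableI_vector vector_derivative_works)
  obtain L where L: "L-lipschitz_on UNIV (coupled_field \<Phi> S Z f)"
    using coupled_field_lipschitz[OF \<open>\<exists>L. L-lipschitz_on UNIV f\<close>] by blast
  obtain Lf where Lf: "Lf-lipschitz_on UNIV f"
    using \<open>\<exists>L. L-lipschitz_on UNIV f\<close> by blast

  have derivative: "((\<lambda>s. reconstruction \<Phi> S (y s) (z s)) has_vector_derivative
      (\<Phi> ** pinv ?A) *v vector_derivative y (at t within J)
        + \<Phi> *v vector_derivative z (at t within J)) (at t within J)"
    if "t \<in> J" "z differentiable (at t within J)" for z t
    using that
    by (intro reconstruction_has_vector_derivative y') (auto simp: vector_derivative_works)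

  have unique_minimizer: "\<exists>!w. instantaneous_minimizer \<Phi> S f J y t z w"
    if "z \<in> null_space ?A" for t z
    using that minimizer by (auto simp: kernel_matrix_range[OF Z])

  have "\<exists>z. optimal_path \<Phi> S f J y z \<and> z 0 = z0 \<and>
          (\<forall>z'. optimal_path \<Phi> S f J y z' \<and> z' 0 = z0 \<longrightarrow> (\<forall>t\<in>J. z' t = z t))"
    if z0: "z0 \<in> null_space ?A" for z0
  proof -
    obtain \<xi>0 where \<xi>0: "z0 = Z *v \<xi>0"
      using z0 kernel_matrix_range[OF Z] by auto
    obtain x where x0: "x 0 = (u 0, \<xi>0)"
      and x: "\<And>t. t \<ge> 0 \<Longrightarrow> (x has_vector_derivative coupled_field \<Phi> S Z f (x t)) (at t within {0..})"
      using lipschitz_ode_global_solution[OF L] by metis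
    have xJ: "(x has_vector_derivative coupled_field \<Phi> S Z f (x t)) (at t within J)" if "t \<in> J" for t
      using has_vector_derivative_within_subset[OF x J(3)] that J(3) by auto
    have fst': "((\<lambda>t. fst (x t)) has_vector_derivative f (fst (x t))) (at t within J)" if "t \<in> J" for t
      using bounded_linear.has_vector_derivative[OF bounded_linear_fst xJ[OF that]]
      by (simp add: coupled_field_def)
    \<comment> \<open>The state component of the coupled solution satisfies the same equation as the
      given \<open>u\<close>, so its observations are \<open>y\<close>.\<close>
    have fst: "fst (x t) = u t" if "t \<in> J" for t
      using lipschitz_ode_unique[OF Lf J, of "\<lambda>t. fst (x t)" u, OF fst' u _ that]
      by (simp add: x0)
    define \<xi> where "\<xi> t = snd (x t)" for t
    have \<xi>: "(\<xi> has_vector_derivative latent_velocity \<Phi> S Z f (y t) (\<xi> t)) (at t within J)"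
      if "t \<in> J" for t
      using bounded_linear.has_vector_derivative[OF bounded_linear_snd xJ[OF that]]
      by (simp add: coupled_field_def fst[OF that] y[OF that] \<xi>_def[abs_def])
    have "optimal_path \<Phi> S f J y (\<lambda>t. Z *v \<xi> t)"
      using \<xi> by (auto simp: path)
    moreover have "Z *v \<xi> 0 = z0"
      by (simp add: \<xi>_def x0 \<xi>0)
    moreover have "z' t = Z *v \<xi> t" if z': "optimal_path \<Phi> S f J y z'" "z' 0 = z0" and t: "t \<in> J" for z' t
    proof -
      obtain \<zeta> where \<zeta>: "\<And>t. t \<in> J \<Longrightarrow> z' t = Z *v \<zeta> t"
        and \<zeta>': "\<And>t. t \<in> J \<Longrightarrow>
          (\<zeta> has_vector_derivative latent_velocity \<Phi> S Z f (y t) (\<zeta> t)) (at t within J)"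
        using z'(1) unfolding path by blast
      have "Z *v \<zeta> 0 = Z *v \<xi>0"
        using \<zeta>[OF \<open>0 \<in> J\<close>] z'(2) \<xi>0 by simp
      then have "\<zeta> 0 = \<xi>0"
        by (metis kernel_matrix_left_inverse[OF Z])
      then have init: "(u 0, \<zeta> 0) = (u 0, \<xi> 0)"
        by (simp add: \<xi>_def x0)
      have "(u t, \<zeta> t) = (u t, \<xi> t)"
        by (rule lipschitz_ode_unique[OF L J, of "\<lambda>t. (u t, \<zeta> t)" "\<lambda>t. (u t, \<xi> t)",
              OF _ _ init t]; rule coupled_field_solution; (assumption | rule y u \<xi> \<zeta>'))
      then show ?thesis using \<zeta>[OF t] by simp
    qed
    ultimately show ?thesis by blast
  qed
  with derivative unique_minimizer show ?thesis
    by (auto simp: minimizer path)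
qed

end
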